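(* Let $M,N\in\mathbb{S}^{n}$ and consider the statements (NS1) there exists $\alpha\in\mathbb{R}$ such that $M+\alpha N\succcurlyeq 0$; (NS2) $x^\top Mx\geqslant 0$ for all $x\in\mathbb{R}^{n}$ with $x^\top Nx=0$; (NS3) $\ker N\cap \{\xi\in\mathbb{R}^n\mid \xi^\top M\xi=0\}\subset \ker M$. Then (NS1) holds if and only if (NS2) and (NS3) both hold. Moreover, if (NS2) and (NS3) hold and in addition $N\succcurlyeq 0$, then there exists $\alpha>0$ such that $M+\alpha N\succcurlyeq 0$; and if (NS2) and (NS3) hold and in addition $N\preccurlyeq 0$, then there exists $\alpha<0$ such that $M+\alpha N\succcurlyeq 0$.
   Context: $\mathbb{S}^n$ denotes the set of real symmetric $n\times n$ matrices. For $S\in\mathbb{S}^n$, $S\succcurlyeq 0$ (resp. $S\preccurlyeq 0$) means that $S$ is positive semi-definite (resp. negative semi-definite). For a matrix $A\in\mathbb{R}^{n\times m}$, $\ker A=\{x\in\mathbb{R}^{m}\mid Ax=0\}$. The symbol $\subset$ denotes (not necessarily proper) set inclusion. *)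

theory Defs
  imports "HOL-Analysis.Analysis"
begin

definition symmetric_matrices :: "(real ^ 'n ^ 'n) set" where
  "symmetric_matrices = {A. transpose A = A}"

definition quadratic_form :: "real ^ 'n ^ 'n \<Rightarrow> real ^ 'n \<Rightarrow> real" where
  "quadratic_form A x = x \<bullet> (A *v x)"

text \<open>Semidefiniteness is a property of symmetric matrices, so symmetry is part of both definitions.\<close>

definition pos_semidef :: "real ^ 'n ^ 'n \<Rightarrow> bool" where
  "pos_semidef A \<longleftrightarrow> A \<in> symmetric_matrices \<and> (\<forall>x. quadratic_form A x \<ge> 0)"

definition neg_semidef :: "real ^ 'n ^ 'n \<Rightarrow> bool" where
  "neg_semidef A \<longleftrightarrow> A \<in> symmetric_matrices \<and> (\<forall>x. quadratic_form A x \<le> 0)"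

definition matrix_ker :: "real ^ 'm ^ 'n \<Rightarrow> (real ^ 'm) set" where
  "matrix_ker A = {x. A *v x = 0}"

end

theory Submission
  imports Defs
begin

text \<open>
  This is the non-strict Finsler lemma. Evaluating \<open>M + \<alpha> N \<succeq> 0\<close> where \<open>N\<close> vanishes gives (NS2), and
  (NS3) holds because a positive semidefinite form vanishes only on the kernel of its matrix
  (\<open>pos_semidef_isotropic_imp_ker\<close>). The converse has two cases of a different nature.

  If \<open>N\<close> is semidefinite, say \<open>N \<succeq> 0\<close>, then (NS2) and (NS3) say that \<open>M\<close> is nonnegative on \<open>ker N\<close>
  and vanishes there only on \<open>K = ker N \<inter> ker M\<close>. Both forms ignore the component of a vector in \<open>K\<close>,
  so only unit vectors orthogonal to \<open>K\<close> matter; there \<open>M > 0\<close> wherever \<open>N = 0\<close>, and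
  compactness provides a large \<open>\<alpha> > 0\<close> (\<open>finsler_psd\<close>). This is where (NS3) is essential: for
  \<open>N = diag(1,0)\<close> and \<open>M\<close> with form \<open>2 x y\<close>, (NS2) holds but no \<open>\<alpha>\<close> exists.

  If \<open>N\<close> is indefinite, \<open>\<alpha>\<close> is constrained from both sides. A vector \<open>x\<close> with \<open>N(x) > 0\<close> demands
  \<open>\<alpha> \<ge> - M(x) / N(x)\<close>, a vector \<open>y\<close> with \<open>N(y) < 0\<close> demands \<open>\<alpha> \<le> - M(y) / N(y)\<close>. The line
  through \<open>x\<close> in direction \<open>y\<close> meets the cone \<open>N = 0\<close> on both sides of \<open>x\<close>, and (NS2) at
  these two points shows that no lower bound exceeds an upper one (\<open>isotropic_nonneg_imp_ratio_le\<close>). So the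
  supremum of the lower bounds is a valid \<open>\<alpha>\<close>.
\<close>

section \<open>Quadratic forms and semidefinite matrices\<close>

lemma quadratic_form_add_scaled:
  "quadratic_form (M + \<alpha> *\<^sub>R N) x = quadratic_form M x + \<alpha> * quadratic_form N x"
  by (simp add: quadratic_form_def matrix_vector_mult_add_rdistrib
      scaleR_matrix_vector_assoc[symmetric] inner_add_right)

lemma quadratic_form_minus: "quadratic_form (- N) x = - quadratic_form N x"
  using quadratic_form_add_scaled[of 0 "-1" N x] by (simp add: quadratic_form_def)

lemma quadratic_form_line:
  "quadratic_form A (x + t *\<^sub>R y) =
     quadratic_form A x + t * (x \<bullet> (A *v y) + y \<bullet> (A *v x)) + t\<^sup>2 * quadratic_form A y"
  by (simp add: quadratic_form_def matrix_vector_right_distrib matrix_vector_mult_scaleR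
      inner_add_left inner_add_right algebra_simps power2_eq_square)

lemma quadratic_form_scaleR: "quadratic_form A (c *\<^sub>R x) = c\<^sup>2 * quadratic_form A x"
  by (simp add: quadratic_form_def matrix_vector_mult_scaleR power2_eq_square)

lemma continuous_on_quadratic_form: "continuous_on S (quadratic_form A)"
  unfolding quadratic_form_def
  by (intro continuous_intros linear_continuous_on matrix_vector_mul_bounded_linear)

lemma symmetric_matrices_add_scaled:
  assumes "M \<in> symmetric_matrices" "N \<in> symmetric_matrices"
  shows "M + \<alpha> *\<^sub>R N \<in> symmetric_matrices"
  using assms by (simp add: symmetric_matrices_def transpose_def vec_eq_iff)

lemma symmetric_matrix_inner:
  assumes "A \<in> symmetric_matrices"
  shows "x \<bullet> (A *v y) = (A *v x) \<bullet> y"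
  using assms dot_lmul_matrix[of x A y] transpose_matrix_vector[of A x]
  by (simp add: symmetric_matrices_def)

lemma matrix_ker_minus: "matrix_ker (- A) = matrix_ker (A :: real ^ 'm ^ 'n)"
proof -
  have "(- A) *v x = - (A *v x)" for x
    by (simp add: matrix_vector_mult_def vec_eq_iff sum_negf)
  then show ?thesis by (simp add: matrix_ker_def)
qed

lemma subspace_matrix_ker: "subspace (matrix_ker A)"
  by (auto simp: matrix_ker_def subspace_def matrix_vector_right_distrib matrix_vector_mult_scaleR)

text \<open>
  A vector where a nonnegative form vanishes is a minimum of the form, so the gradient \<open>2 A x\<close>
  vanishes as well.
\<close>

lemma pos_semidef_isotropic_imp_ker:
  assumes "pos_semidef A" "quadratic_form A x = 0"
  shows "x \<in> matrix_ker A"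
proof (rule ccontr)
  assume "x \<notin> matrix_ker A"
  define y where "y = A *v x"
  define a where "a = y \<bullet> y"
  define c where "c = quadratic_form A y"
  have "a > 0"
    using \<open>x \<notin> matrix_ker A\<close> by (simp add: a_def y_def matrix_ker_def)
  have "c \<ge> 0"
    using assms(1) by (simp add: pos_semidef_def c_def)
  have "x \<bullet> (A *v y) = a"
    using assms(1) symmetric_matrix_inner[of A x y] by (simp add: pos_semidef_def a_def y_def)
  then have line: "quadratic_form A (x + t *\<^sub>R y) = 2 * a * t + c * t\<^sup>2" for t
    using assms(2) by (simp add: quadratic_form_line a_def c_def) (simp add: y_def)
  \<comment> \<open>A step against the gradient, short enough for the linear term to dominate; the \<open>1\<close> covers \<open>c = 0\<close>.\<close>
  define t where "t = - a / (c + 1)"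
  have "2 * a * t + c * t\<^sup>2 = - (a\<^sup>2 * (c + 2)) / (c + 1)\<^sup>2"
    using \<open>c \<ge> 0\<close> by (simp add: t_def divide_simps power2_eq_square) (simp add: algebra_simps)
  also have "\<dots> < 0"
    using \<open>a > 0\<close> \<open>c \<ge> 0\<close> by (simp add: divide_neg_pos)
  finally have "quadratic_form A (x + t *\<^sub>R y) < 0"
    by (simp add: line)
  then show False
    using assms(1) by (simp add: pos_semidef_def not_le[symmetric])
qed

text \<open>
  Of the four terms of the expansion, \<open>A k = 0\<close> removes two directly; the cross term \<open>k \<bullet> A w\<close>
  vanishes because symmetry turns it into \<open>A k \<bullet> w\<close>.
\<close>

lemma quadratic_form_add_ker:
  assumes "A \<in> symmetric_matrices" "k \<in> matrix_ker A"
  shows "quadratic_form A (k + w) = quadratic_form A w"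
  using assms(2) symmetric_matrix_inner[OF assms(1), of k w]
  by (simp add: quadratic_form_def matrix_ker_def matrix_vector_right_distrib inner_add_left)

section \<open>A semidefinite constraint matrix\<close>

text \<open>
  Trouble can only come from the compact set where \<open>f \<le> 0\<close>. There \<open>g\<close> is positive, hence bounded away
  from \<open>0\<close>, while \<open>f\<close> is bounded below.
\<close>

lemma compact_exists_penalty:
  fixes f g :: "'a::t2_space \<Rightarrow> real"
  assumes "compact S" "continuous_on S f" "continuous_on S g"
    and g_nonneg: "\<And>x. x \<in> S \<Longrightarrow> g x \<ge> 0"
    and f_pos: "\<And>x. x \<in> S \<Longrightarrow> g x = 0 \<Longrightarrow> f x > 0"
  shows "\<exists>\<alpha>>0. \<forall>x\<in>S. f x + \<alpha> * g x \<ge> 0"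
proof -
  define T where "T = {x \<in> S. f x \<le> 0}"
  have "closed T"
    unfolding T_def using assms(1,2)
    by (intro continuous_on_closed_Collect_le continuous_intros compact_imp_closed) auto
  then have "compact T"
    using compact_Int_closed[OF \<open>compact S\<close>, of T] by (simp add: T_def Int_absorb1 Collect_restrict)
  have cont: "continuous_on T f" "continuous_on T g"
    using assms(2,3) by (auto intro: continuous_on_subset simp: T_def)
  show ?thesis
  proof (cases "T = {}")
    case True
    then have "\<forall>x\<in>S. f x + 1 * g x \<ge> 0"
      using g_nonneg by (fastforce simp: T_def)
    then show ?thesis using zero_less_one by blast
  next
    case False
    obtain p where p: "p \<in> T" "\<And>x. x \<in> T \<Longrightarrow> f p \<le> f x"
      using continuous_attains_inf[OF \<open>compact T\<close> False cont(1)] by blast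
    obtain r where r: "r \<in> T" "\<And>x. x \<in> T \<Longrightarrow> g r \<le> g x"
      using continuous_attains_inf[OF \<open>compact T\<close> False cont(2)] by blast
    have "g r > 0"
      using r(1) g_nonneg[of r] f_pos[of r] by (fastforce simp: T_def)
    have "f p \<le> 0"
      using p(1) by (simp add: T_def)
    \<comment> \<open>The summand \<open>1\<close> keeps \<open>\<alpha>\<close> positive if \<open>f p = 0\<close>.\<close>
    define \<alpha> where "\<alpha> = 1 - f p / g r"
    have "\<alpha> > 0"
      using \<open>g r > 0\<close> \<open>f p \<le> 0\<close> divide_nonpos_pos[of "f p" "g r"] by (simp add: \<alpha>_def)
    have "f x + \<alpha> * g x \<ge> 0" if "x \<in> S" for x
    proof (cases "f x \<le> 0")
      case True
      then have "x \<in> T" using that by (simp add: T_def)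
      have "- f p \<le> \<alpha> * g r"
        using \<open>g r > 0\<close> by (simp add: \<alpha>_def algebra_simps)
      also have "\<dots> \<le> \<alpha> * g x"
        using r(2)[OF \<open>x \<in> T\<close>] \<open>\<alpha> > 0\<close> by simp
      finally show ?thesis using p(2)[OF \<open>x \<in> T\<close>] by linarith
    next
      case False
      then show ?thesis using g_nonneg[OF that] \<open>\<alpha> > 0\<close> by simp
    qed
    then show ?thesis using \<open>\<alpha> > 0\<close> by blast
  qed
qed

text \<open>
  Splitting off \<open>K = ker N \<inter> ker M\<close> turns the nonnegativity of \<open>M\<close> on \<open>ker N\<close> into strict positivity:
  by (NS3), a vector of \<open>ker N\<close> where the form of \<open>M\<close> vanishes lies in \<open>K\<close>, and no unit vector
  orthogonal to \<open>K\<close> does.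
\<close>

lemma finsler_psd:
  fixes M N :: "real ^ 'n ^ 'n"
  assumes M: "M \<in> symmetric_matrices" and N: "pos_semidef N"
    and isotropic: "\<And>x. quadratic_form N x = 0 \<Longrightarrow> quadratic_form M x \<ge> 0"
    and ker: "matrix_ker N \<inter> {\<xi>. quadratic_form M \<xi> = 0} \<subseteq> matrix_ker M"
  shows "\<exists>\<alpha>>0. pos_semidef (M + \<alpha> *\<^sub>R N)"
proof -
  have N': "N \<in> symmetric_matrices"
    using N by (simp add: pos_semidef_def)
  define K where "K = matrix_ker N \<inter> matrix_ker M"
  have "subspace K"
    by (simp add: K_def subspace_inter subspace_matrix_ker)
  define S where "S = sphere 0 1 \<inter> {w. \<forall>k\<in>K. orthogonal k w}"
  have "compact S"
    unfolding S_def
    by (intro compact_Int_closed compact_sphere closed_subspace subspace_orthogonal_to_vectors)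
  moreover have "quadratic_form N w \<ge> 0" for w
    using N by (simp add: pos_semidef_def)
  moreover have "quadratic_form M w > 0" if "w \<in> S" "quadratic_form N w = 0" for w
  proof (rule ccontr)
    assume "\<not> quadratic_form M w > 0"
    then have "quadratic_form M w = 0"
      using isotropic[OF that(2)] by simp
    then have "w \<in> K"
      using ker pos_semidef_isotropic_imp_ker[OF N that(2)] by (auto simp: K_def)
    then show False
      using that(1) by (auto simp: S_def orthogonal_self)
  qed
  ultimately obtain \<alpha> where "\<alpha> > 0"
    and \<alpha>: "\<And>w. w \<in> S \<Longrightarrow> quadratic_form M w + \<alpha> * quadratic_form N w \<ge> 0"
    using compact_exists_penalty[of S "quadratic_form M" "quadratic_form N"]
      continuous_on_quadratic_form by blast
  have "quadratic_form (M + \<alpha> *\<^sub>R N) x \<ge> 0" for x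
  proof -
    obtain k z where kz: "k \<in> span K" "\<And>k. k \<in> span K \<Longrightarrow> orthogonal z k" "x = k + z"
      using orthogonal_subspace_decomp_exists[of K x] by metis
    have "k \<in> K"
      using kz(1) \<open>subspace K\<close> span_eq_iff[of K] by blast
    then have x: "quadratic_form (M + \<alpha> *\<^sub>R N) x = quadratic_form (M + \<alpha> *\<^sub>R N) z"
      using quadratic_form_add_ker[OF M, of k z] quadratic_form_add_ker[OF N', of k z]
      by (simp add: quadratic_form_add_scaled kz(3) K_def)
    show ?thesis
    proof (cases "z = 0")
      case True
      then show ?thesis using x by (simp add: quadratic_form_def)
    next
      case False
      define w where "w = (1 / norm z) *\<^sub>R z"
      have "w \<in> S"
        using False kz(2) by (auto simp: S_def w_def orthogonal_commute orthogonal_clauses span_base)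
      then have "quadratic_form (M + \<alpha> *\<^sub>R N) w \<ge> 0"
        using \<alpha> by (simp add: quadratic_form_add_scaled)
      moreover have "z = norm z *\<^sub>R w"
        using False by (simp add: w_def)
      ultimately show ?thesis
        using x quadratic_form_scaleR[of "M + \<alpha> *\<^sub>R N" "norm z" w] by simp
    qed
  qed
  then show ?thesis
    using \<open>\<alpha> > 0\<close> symmetric_matrices_add_scaled[OF M N'] by (auto simp: pos_semidef_def)
qed

corollary finsler_nsd:
  fixes M N :: "real ^ 'n ^ 'n"
  assumes M: "M \<in> symmetric_matrices" and N: "neg_semidef N"
    and isotropic: "\<And>x. quadratic_form N x = 0 \<Longrightarrow> quadratic_form M x \<ge> 0"
    and ker: "matrix_ker N \<inter> {\<xi>. quadratic_form M \<xi> = 0} \<subseteq> matrix_ker M"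
  shows "\<exists>\<alpha><0. pos_semidef (M + \<alpha> *\<^sub>R N)"
proof -
  have "- N \<in> symmetric_matrices"
    using N by (simp add: neg_semidef_def symmetric_matrices_def transpose_def vec_eq_iff)
  then have "pos_semidef (- N)"
    using N by (simp add: pos_semidef_def neg_semidef_def quadratic_form_minus)
  then obtain \<alpha> where "\<alpha> > 0" "pos_semidef (M + \<alpha> *\<^sub>R (- N))"
    using finsler_psd[of M "- N"] M isotropic ker
    by (auto simp: quadratic_form_minus matrix_ker_minus)
  then show ?thesis
    by (intro exI[of _ "- \<alpha>"]) simp
qed

section \<open>An indefinite constraint matrix\<close>

text \<open>
  The quadratic \<open>t \<mapsto> N(x + t y)\<close> has roots \<open>s < 0 < u\<close> with \<open>s u = N(x) / N(y)\<close>. The weights \<open>-s\<close>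
  and \<open>u\<close> eliminate the mixed term from \<open>M(x + u y) \<ge> 0\<close> and \<open>M(x + s y) \<ge> 0\<close>, leaving
  \<open>M(x) - s u M(y) \<ge> 0\<close>. Clearing the denominator \<open>N(y) < 0\<close> gives the conclusion.
\<close>

lemma isotropic_nonneg_imp_ratio_le:
  assumes isotropic: "\<And>x. quadratic_form N x = 0 \<Longrightarrow> quadratic_form M x \<ge> 0"
    and x: "quadratic_form N x > 0" and y: "quadratic_form N y < 0"
  shows "- quadratic_form M x / quadratic_form N x \<le> - quadratic_form M y / quadratic_form N y"
proof -
  define a where "a = quadratic_form N y"
  define b where "b = x \<bullet> (N *v y) + y \<bullet> (N *v x)"
  define c where "c = quadratic_form N x"
  define m where "m = x \<bullet> (M *v y) + y \<bullet> (M *v x)"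
  have "a < 0" "c > 0"
    using x y by (simp_all add: a_def c_def)
  have N_line: "quadratic_form N (x + t *\<^sub>R y) = a * t\<^sup>2 + b * t + c" for t
    by (simp add: quadratic_form_line a_def b_def c_def)
  have M_line: "quadratic_form M (x + t *\<^sub>R y) = quadratic_form M x + t * m + t\<^sup>2 * quadratic_form M y" for t
    by (simp add: quadratic_form_line m_def)

  define d where "d = sqrt (b\<^sup>2 - 4 * a * c)"
  have "a * c < 0"
    using \<open>a < 0\<close> \<open>c > 0\<close> by (rule mult_neg_pos)
  then have "sqrt (b\<^sup>2) < d"
    unfolding d_def by (intro real_sqrt_less_mono) simp
  then have "d > - b"
    by simp
  have d2: "d\<^sup>2 = b\<^sup>2 - 4 * a * c"
  proof -
    have "b\<^sup>2 - 4 * a * c \<ge> 0"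
      using \<open>a * c < 0\<close> zero_le_power2[of b] by linarith
    then show ?thesis by (simp add: d_def)
  qed
  define u where "u = (b + d) / (- 2 * a)"
  have "u > 0"
    using \<open>d > - b\<close> \<open>a < 0\<close> unfolding u_def by (intro divide_pos_pos) auto
  have d_eq: "d = - 2 * a * u - b"
    using \<open>a < 0\<close> by (simp add: u_def)
  have "4 * a * (a * u\<^sup>2 + b * u + c) = 0"
    using d2 unfolding d_eq by (simp add: power2_eq_square algebra_simps)
  then have u_root: "a * u\<^sup>2 + b * u + c = 0"
    using \<open>a < 0\<close> by simp

  \<comment> \<open>The other root, by Vieta.\<close>
  define s where "s = c / (a * u)"
  have "s < 0"
    using \<open>u > 0\<close> \<open>a < 0\<close> \<open>c > 0\<close> by (simp add: s_def divide_pos_neg mult_neg_pos)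
  have "s * u = c / a"
    using \<open>u > 0\<close> by (simp add: s_def)
  have "a * s\<^sup>2 + b * s + c = c * (a * u\<^sup>2 + b * u + c) / (a * u\<^sup>2)"
    using \<open>u > 0\<close> \<open>a < 0\<close> by (simp add: s_def field_simps power2_eq_square)
  then have s_root: "a * s\<^sup>2 + b * s + c = 0"
    by (simp add: u_root)

  have "0 \<le> - s * quadratic_form M (x + u *\<^sub>R y) + u * quadratic_form M (x + s *\<^sub>R y)"
    using \<open>s < 0\<close> \<open>u > 0\<close> isotropic N_line u_root s_root
    by (intro add_nonneg_nonneg mult_nonneg_nonneg) auto
  also have "\<dots> = (u - s) * (quadratic_form M x - s * u * quadratic_form M y)"
    by (simp add: M_line power2_eq_square algebra_simps)
  finally have "quadratic_form M x - c / a * quadratic_form M y \<ge> 0"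
    using \<open>s < 0\<close> \<open>u > 0\<close> unfolding \<open>s * u = c / a\<close> by (simp add: zero_le_mult_iff)
  then show ?thesis
    using \<open>a < 0\<close> \<open>c > 0\<close> unfolding a_def[symmetric] c_def[symmetric] by (simp add: field_simps)
qed

text \<open>
  A vector with \<open>N(x) \<noteq> 0\<close> bounds \<open>\<alpha>\<close> from one side only, according to the sign of \<open>N(x)\<close>; both kinds occur,
  so the set \<open>L\<close> of lower bounds is nonempty and bounded above.
\<close>

lemma s_lemma_indefinite:
  fixes M N :: "real ^ 'n ^ 'n"
  assumes M: "M \<in> symmetric_matrices" and N: "N \<in> symmetric_matrices"
    and isotropic: "\<And>x. quadratic_form N x = 0 \<Longrightarrow> quadratic_form M x \<ge> 0"
    and pos: "\<exists>x. quadratic_form N x > 0" and neg: "\<exists>x. quadratic_form N x < 0"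
  shows "\<exists>\<alpha>. pos_semidef (M + \<alpha> *\<^sub>R N)"
proof -
  let ?ratio = "\<lambda>x. - quadratic_form M x / quadratic_form N x"
  define L where "L = ?ratio ` {x. quadratic_form N x > 0}"
  have "L \<noteq> {}"
    using pos by (auto simp: L_def)
  have L_le: "l \<le> ?ratio y" if "l \<in> L" "quadratic_form N y < 0" for l y
    using that isotropic_nonneg_imp_ratio_le[OF isotropic] by (auto simp: L_def)
  then have "bdd_above L"
    using neg by (auto simp: bdd_above_def)
  define \<alpha> where "\<alpha> = Sup L"
  have "quadratic_form M x + \<alpha> * quadratic_form N x \<ge> 0" for x
  proof (cases "quadratic_form N x" "0 :: real" rule: linorder_cases)
    case less
    then have "\<alpha> \<le> ?ratio x"
      unfolding \<alpha>_def using L_le by (intro cSup_least \<open>L \<noteq> {}\<close>)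
    then show ?thesis using less by (simp add: field_simps)
  next
    case equal
    then show ?thesis using isotropic by simp
  next
    case greater
    then have "?ratio x \<le> \<alpha>"
      unfolding \<alpha>_def using \<open>bdd_above L\<close> by (intro cSup_upper) (auto simp: L_def)
    then show ?thesis using greater by (simp add: field_simps)
  qed
  then show ?thesis
    using symmetric_matrices_add_scaled[OF M N]
    by (auto simp: pos_semidef_def quadratic_form_add_scaled)
qed

section \<open>The non-strict Finsler lemma\<close>

text \<open>
  On \<open>ker N\<close> the pencil \<open>M + \<alpha> N\<close> acts as \<open>M\<close>, so (NS3) is the fact about isotropic
  vectors of a semidefinite matrix, applied to the pencil.
\<close>

lemma pos_semidef_pencil_imp_ker:
  assumes "pos_semidef (M + \<alpha> *\<^sub>R N)"
  shows "matrix_ker N \<inter> {\<xi>. quadratic_form M \<xi> = 0} \<subseteq> matrix_ker M"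
proof
  fix x
  assume "x \<in> matrix_ker N \<inter> {\<xi>. quadratic_form M \<xi> = 0}"
  then have x: "N *v x = 0" "quadratic_form M x = 0"
    by (auto simp: matrix_ker_def)
  then have "quadratic_form (M + \<alpha> *\<^sub>R N) x = 0"
    by (simp add: quadratic_form_add_scaled) (simp add: quadratic_form_def)
  then have "(M + \<alpha> *\<^sub>R N) *v x = 0"
    using pos_semidef_isotropic_imp_ker[OF assms] by (simp add: matrix_ker_def)
  then show "x \<in> matrix_ker M"
    using x(1) by (simp add: matrix_ker_def matrix_vector_mult_add_rdistrib
        scaleR_matrix_vector_assoc[symmetric])
qed

theorem theorem1:
  fixes M N :: "real ^ 'n ^ 'n"
  assumes "M \<in> symmetric_matrices" and "N \<in> symmetric_matrices"
  shows "((\<exists>\<alpha>::real. pos_semidef (M + \<alpha> *\<^sub>R N)) \<longleftrightarrow>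
            (\<forall>x. quadratic_form N x = 0 \<longrightarrow> quadratic_form M x \<ge> 0) \<and>
            matrix_ker N \<inter> {\<xi>. quadratic_form M \<xi> = 0} \<subseteq> matrix_ker M)
       \<and> ((\<forall>x. quadratic_form N x = 0 \<longrightarrow> quadratic_form M x \<ge> 0) \<and>
            matrix_ker N \<inter> {\<xi>. quadratic_form M \<xi> = 0} \<subseteq> matrix_ker M \<and>
            pos_semidef N
            \<longrightarrow> (\<exists>\<alpha>::real. \<alpha> > 0 \<and> pos_semidef (M + \<alpha> *\<^sub>R N)))
       \<and> ((\<forall>x. quadratic_form N x = 0 \<longrightarrow> quadratic_form M x \<ge> 0) \<and>
            matrix_ker N \<inter> {\<xi>. quadratic_form M \<xi> = 0} \<subseteq> matrix_ker M \<and>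
            neg_semidef N
            \<longrightarrow> (\<exists>\<alpha>::real. \<alpha> < 0 \<and> pos_semidef (M + \<alpha> *\<^sub>R N)))"
proof -
  let ?NS1 = "\<exists>\<alpha>::real. pos_semidef (M + \<alpha> *\<^sub>R N)"
  let ?NS2 = "\<forall>x. quadratic_form N x = 0 \<longrightarrow> quadratic_form M x \<ge> 0"
  let ?NS3 = "matrix_ker N \<inter> {\<xi>. quadratic_form M \<xi> = 0} \<subseteq> matrix_ker M"
  have psd: "\<exists>\<alpha>>0. pos_semidef (M + \<alpha> *\<^sub>R N)" if "?NS2" "?NS3" "pos_semidef N"
    using finsler_psd[OF assms(1)] that by blast
  have nsd: "\<exists>\<alpha><0. pos_semidef (M + \<alpha> *\<^sub>R N)" if "?NS2" "?NS3" "neg_semidef N"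
    using finsler_nsd[OF assms(1)] that by blast
  have "?NS2" if "?NS1"
    using that by (auto simp: pos_semidef_def quadratic_form_add_scaled)
      (metis add.right_neutral mult_zero_right)
  moreover have "?NS3" if "?NS1"
    using that pos_semidef_pencil_imp_ker by blast
  moreover have "?NS1" if "?NS2" "?NS3"
  proof -
    consider "pos_semidef N" | "neg_semidef N"
      | "\<exists>x. quadratic_form N x > 0" "\<exists>x. quadratic_form N x < 0"
      using assms(2) by (auto simp: pos_semidef_def neg_semidef_def not_le[symmetric])
    then show ?thesis
    proof cases
      case 1
      then show ?thesis using psd[OF that] by blast
    next
      case 2
      then show ?thesis using nsd[OF that] by blast
    next
      case 3
      then show ?thesis using s_lemma_indefinite[OF assms] that(1) by blast
    qed
  qed
  ultimately show ?thesis
    using psd nsd by blast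
qed

end
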